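(* Let $\kappa$ be an infinite cardinal such that $\kappa^\omega=\kappa$, and let $P$ be a non-empty subset of $\beta\mathbb{N}\setminus\mathbb{N}$ satisfying $|P|\le\kappa$. Then there exists a dense subgroup of $\mathbb{Z}_2^\kappa$ which (with the subspace topology) is strongly $P$-pseudocompact and contains no non-trivial convergent sequences.
   Context: $\mathbb{Z}_2$ is the two-element group with the discrete topology, and $\mathbb{Z}_2^\kappa$ carries the product topology. $\beta\mathbb{N}\setminus\mathbb{N}$ is identified with the set of all free (non-principal) ultrafilters on $\mathbb{N}$. For a free ultrafilter $p$ on $\mathbb{N}$, a point $x$ of a space $X$ is a $p$-limit of a sequence $\{x_n:n\in\mathbb{N}\}$ of points of $X$ if $\{n\in\mathbb{N}:x_n\in V\}\in p$ for every neighbourhood $V$ of $x$ in $X$. A space $X$ is strongly $p$-pseudocompact if for every sequence $\{U_n:n\in\mathbb{N}\}$ of non-empty open subsets of $X$ one can choose a point $x_n\in U_n$ for each $n\in\mathbb{N}$ in such a way that the sequence $\{x_n:n\in\mathbb{N}\}$ has a $p$-limit in $X$. For a non-empty $P\subseteq\beta\mathbb{N}\setminus\mathbb{N}$, a space is strongly $P$-pseudocompact if it is strongly $p$-pseudocompact for each $p\in P$. A convergent sequence is non-trivial if it is not eventually constant. *)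

theory Defs
  imports "HOL-Analysis.Analysis" "HOL-Algebra.Product_Groups"
begin

unbundle cardinal_syntax

text \<open>
  A set \<open>A\<close> belongs to an ultrafilter \<open>p\<close>, represented as a value of the library type of filters,
  iff \<open>eventually (\<lambda>n. n \<in> A) p\<close>.  The type also contains the improper filter \<open>bot\<close>, which has to
  be excluded.
\<close>

definition ultrafilter :: "'a filter \<Rightarrow> bool" where
  "ultrafilter p \<longleftrightarrow>
     p \<noteq> bot \<and> (\<forall>A. eventually (\<lambda>n. n \<in> A) p \<or> eventually (\<lambda>n. n \<notin> A) p)"

definition free_ultrafilter :: "'a filter \<Rightarrow> bool" where
  "free_ultrafilter p \<longleftrightarrow> ultrafilter p \<and> (\<forall>n. p \<noteq> principal {n})"

definition beta_remainder :: "nat filter set" where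
  "beta_remainder = {p. free_ultrafilter p}"

text \<open>
  A \<open>p\<close>-limit of a sequence \<open>x\<close> in \<open>X\<close> is \<^const>\<open>limitin\<close> along the filter \<open>p\<close>; it suffices to test
  open neighbourhoods since \<open>p\<close> is upward closed.
\<close>

definition strongly_p_pseudocompact :: "nat filter \<Rightarrow> 'a topology \<Rightarrow> bool" where
  "strongly_p_pseudocompact p X \<longleftrightarrow>
     (\<forall>U :: nat \<Rightarrow> 'a set. (\<forall>n. openin X (U n) \<and> U n \<noteq> {}) \<longrightarrow>
        (\<exists>x. (\<forall>n. x n \<in> U n) \<and> (\<exists>l. limitin X x l p)))"

definition strongly_P_pseudocompact :: "nat filter set \<Rightarrow> 'a topology \<Rightarrow> bool" where
  "strongly_P_pseudocompact P X \<longleftrightarrow> (\<forall>p\<in>P. strongly_p_pseudocompact p X)"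

definition has_nontrivial_convergent_sequence :: "'a topology \<Rightarrow> bool" where
  "has_nontrivial_convergent_sequence X \<longleftrightarrow>
     (\<exists>x :: nat \<Rightarrow> 'a. (\<forall>n. x n \<in> topspace X) \<and> (\<exists>l. limitin X x l sequentially) \<and>
        \<not> (\<exists>c. eventually (\<lambda>n. x n = c) sequentially))"

text \<open>
  The cardinal \<open>\<kappa>\<close> is a cardinal order in the sense of the library; its field is a set of
  cardinality \<open>\<kappa>\<close> and serves as the index set of the power.
\<close>

definition Z2_power_group :: "'k rel \<Rightarrow> ('k \<Rightarrow> int) monoid" where
  "Z2_power_group \<kappa> = product_group (Field \<kappa>) (\<lambda>_. integer_mod_group 2)"

definition Z2_power_topology :: "'k rel \<Rightarrow> ('k \<Rightarrow> int) topology" where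
  "Z2_power_topology \<kappa> =
     product_topology (\<lambda>_. discrete_topology (carrier (integer_mod_group 2))) (Field \<kappa>)"

end

theory Submission
  imports Defs
begin

text \<open>
  Let \<open>I\<close> consist of the pairs of an ultrafilter \<open>p \<in> P\<close> and a sequence of basic open sets.  The
  subgroup is generated by points \<open>x\<^bsub>i,n\<^esub>\<close> (\<open>n \<in> \<nat>\<close>), chosen in the \<open>n\<close>-th open set of \<open>i \<in> I\<close>,
  together with their \<open>p\<close>-limits.  Everything is decided coordinate by coordinate: at a coordinate
  \<open>\<xi>\<close> only those \<open>x\<^bsub>i,n\<^esub>(\<xi>)\<close> are prescribed for which \<open>\<xi>\<close> lies in the finite support of the
  \<open>n\<close>-th open set, and the value at the limit is forced.  Since \<open>\<kappa>\<^sup>\<omega> = \<kappa>\<close>, there are only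
  \<open>\<kappa>\<close> injective sequences \<open>s\<close> of formal finite sums of generators, and \<open>\<kappa>\<close> many coordinates can be
  reserved for each of them.  The supports that constrain the countably many generators in \<open>s\<close>
  form a countable set, so some coordinate reserved for \<open>s\<close> leaves these generators free, and there
  they can be given values for which \<open>s\<close> takes the value \<open>1\<close> infinitely often: differences of terms of
  \<open>s\<close> yield pairwise disjoint nonempty sums, from infinitely many of which one picks one generator
  each.  So no \<open>s\<close> tends to \<open>0\<close>.
\<close>

section \<open>Parity and symmetric differences of finite sets\<close>

lemma odd_card_sym_diff:
  assumes "finite A" "finite B"
  shows "odd (card {x \<in> sym_diff A B. v x}) \<longleftrightarrow> odd (card {x \<in> A. v x}) \<noteq> odd (card {x \<in> B. v x})"
proof -
  let ?S = "\<lambda>C. {x \<in> C. v x}"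
  have "card (?S A) = card (?S (A - B)) + card (?S (A \<inter> B))"
    using assms by (subst card_Un_disjoint [symmetric]) (auto intro: arg_cong [where f = card])
  moreover have "card (?S B) = card (?S (B - A)) + card (?S (A \<inter> B))"
    using assms by (subst card_Un_disjoint [symmetric]) (auto intro: arg_cong [where f = card])
  moreover have "card (?S (sym_diff A B)) = card (?S (A - B)) + card (?S (B - A))"
    using assms by (subst card_Un_disjoint [symmetric]) (auto intro: arg_cong [where f = card])
  ultimately show ?thesis by (simp only: even_add) blast
qed

text \<open>Pigeonhole: a finite set \<open>E\<close> has only finitely many subsets, so two
  arbitrarily late terms of \<open>s\<close> have the same trace on \<open>E\<close>, and their
  symmetric difference misses \<open>E\<close>. Iterating with \<open>E\<close> as the union of the
  earlier differences makes all differences disjoint.\<close>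

lemma ex_disjoint_sym_diffs:
  fixes s :: "nat \<Rightarrow> 'x set"
  assumes inj: "inj s" and fin: "\<And>k. finite (s k)"
  shows "\<exists>a b. (\<forall>j. j \<le> a j \<and> j \<le> b j \<and> s (a j) \<noteq> s (b j)) \<and>
    disjoint_family (\<lambda>j. sym_diff (s (a j)) (s (b j)))"
proof -
  have step: "\<exists>a\<ge>n. \<exists>b\<ge>n. s a \<noteq> s b \<and> E \<inter> sym_diff (s a) (s b) = {}" if "finite E" for n E
  proof -
    have "\<not> inj_on (\<lambda>k. s k \<inter> E) {n..}"
    proof
      assume "inj_on (\<lambda>k. s k \<inter> E) {n..}"
      moreover have "(\<lambda>k. s k \<inter> E) ` {n..} \<subseteq> Pow E" by auto
      ultimately have "finite {n..}"
        using that by (meson finite_Pow_iff inj_on_finite)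
      then show False by (simp add: infinite_Ici)
    qed
    then obtain a b where "a \<ge> n" "b \<ge> n" "a \<noteq> b" "s a \<inter> E = s b \<inter> E"
      by (auto simp: inj_on_def)
    moreover from this have "s a \<noteq> s b" using inj by (simp add: inj_eq)
    moreover have "E \<inter> sym_diff (s a) (s b) = {}" using \<open>s a \<inter> E = s b \<inter> E\<close> by blast
    ultimately show ?thesis by blast
  qed
  define D where "D = (\<lambda>(a, b, E::'x set). sym_diff (s a) (s b))"
  \<comment> \<open>The third component is the state of the recursion: it collects the differences
    chosen so far, and the current one has to avoid it.\<close>
  define good where "good n = (\<lambda>(a, b, E). finite E \<and> a \<ge> n \<and> b \<ge> n \<and> s a \<noteq> s b \<and> E \<inter> D (a, b, E) = {})" for n
  have "\<exists>f. \<forall>n. good n (f n) \<and> snd (snd (f (Suc n))) = snd (snd (f n)) \<union> D (f n)"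
  proof (rule dependent_nat_choice)
    show "\<exists>x. good 0 x"
      using step[of "{}" 0] by (auto simp: D_def good_def)
    show "\<exists>y. good (Suc n) y \<and> snd (snd y) = snd (snd x) \<union> D x" if "good n x" for x n
    proof -
      have "finite (snd (snd x) \<union> D x)"
        using that fin by (auto simp: D_def good_def split: prod.splits)
      from step[OF this, of "Suc n"] obtain a b where "a \<ge> Suc n" "b \<ge> Suc n" "s a \<noteq> s b"
        "(snd (snd x) \<union> D x) \<inter> sym_diff (s a) (s b) = {}" by blast
      with \<open>finite (snd (snd x) \<union> D x)\<close> show ?thesis
        by (intro exI[of _ "(a, b, snd (snd x) \<union> D x)"]) (simp add: D_def good_def)
    qed
  qed
  then obtain f where f: "\<And>n. good n (f n)"
    "\<And>n. snd (snd (f (Suc n))) = snd (snd (f n)) \<union> D (f n)" by blast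
  define a where "a = fst \<circ> f"
  define b where "b = fst \<circ> snd \<circ> f"
  define E where "E = snd \<circ> snd \<circ> f"
  have Df: "D (f n) = sym_diff (s (a n)) (s (b n))" for n
    by (simp add: D_def a_def b_def split: prod.splits)
  have f': "a n \<ge> n" "b n \<ge> n" "s (a n) \<noteq> s (b n)" "E n \<inter> D (f n) = {}" for n
    using f(1)[of n] by (auto simp: good_def a_def b_def E_def split: prod.splits)
  have E: "E (Suc n) = E n \<union> D (f n)" for n
    using f(2) by (simp add: E_def)
  have "mono E" unfolding mono_iff_le_Suc using E by auto
  have lt: "D (f i) \<inter> D (f j) = {}" if "i < j" for i j
  proof -
    have "D (f i) \<subseteq> E (Suc i)" using E by auto
    also have "\<dots> \<subseteq> E j" using that \<open>mono E\<close> by (simp add: Suc_leI monoD)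
    finally show ?thesis using f'(4)[of j] by auto
  qed
  have "disjoint_family (\<lambda>j. sym_diff (s (a j)) (s (b j)))"
    unfolding disjoint_family_on_def Df[symmetric]
    using lt by (metis Int_commute linorder_neqE_nat)
  with f' show ?thesis by blast
qed

section \<open>Free ultrafilters and the choice of values at generators\<close>

lemma free_ultrafilter_not_eventually_finite:
  assumes p: "free_ultrafilter p" and "finite F"
  shows "\<not> eventually (\<lambda>n. n \<in> F) p"
  using \<open>finite F\<close>
proof induction
  case empty
  then show ?case using p by (simp add: free_ultrafilter_def ultrafilter_def trivial_limit_def)
next
  case (insert a F)
  have "\<not> eventually (\<lambda>n. n \<in> {a}) p"
  proof
    assume *: "eventually (\<lambda>n. n \<in> {a}) p"
    have "p = principal {a}"
    proof (rule filter_eqI)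
      fix Q
      show "eventually Q p \<longleftrightarrow> eventually Q (principal {a})"
      proof
        assume "eventually Q p"
        with * have "eventually (\<lambda>n. n = a \<and> Q n) p" by eventually_elim auto
        moreover have "p \<noteq> bot" using p by (simp add: free_ultrafilter_def ultrafilter_def)
        ultimately have "\<exists>n. n = a \<and> Q n" using eventually_happens' by blast
        then show "eventually Q (principal {a})" by (auto simp: eventually_principal)
      next
        assume "eventually Q (principal {a})"
        then show "eventually Q p"
          using * by (auto simp: eventually_principal elim: eventually_mono)
      qed
    qed
    then show False using p by (simp add: free_ultrafilter_def)
  qed
  then have "eventually (\<lambda>n. n \<notin> {a}) p"
    using p unfolding free_ultrafilter_def ultrafilter_def by blast
  then have "eventually (\<lambda>n. n \<in> F) p" if "eventually (\<lambda>n. n \<in> insert a F) p"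
    using that by eventually_elim auto
  then show ?case using insert.IH by blast
qed

text \<open>\<open>(i, Some n)\<close> stands for the generator \<open>x\<^bsub>i,n\<^esub>\<close> and \<open>(i, None)\<close> for the limit of these along \<open>p i\<close>.\<close>

definition ultra_extend :: "('i \<Rightarrow> nat filter) \<Rightarrow> ('i \<Rightarrow> nat \<Rightarrow> bool) \<Rightarrow> 'i \<times> nat option \<Rightarrow> bool" where
  "ultra_extend p c x =
     (case snd x of None \<Rightarrow> eventually (c (fst x)) (p (fst x)) | Some n \<Rightarrow> c (fst x) n)"

lemma ultra_extend_simps [simp]:
  "ultra_extend p c (i, None) = eventually (c i) (p i)"
  "ultra_extend p c (i, Some n) = c i n"
  by (simp_all add: ultra_extend_def)

text \<open>Used to give the value 1 to infinitely many generators while every limit keeps the value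
  0. If one index occurs infinitely often, two disjoint halves of its occurrences cannot both lie in
  its ultrafilter. Otherwise infinitely many indices occur; keeping one generator for each leaves
  only finite sets, which no free ultrafilter contains.\<close>

lemma ex_infinite_subset_not_in_ultrafilters:
  fixes x :: "nat \<Rightarrow> 'i \<times> nat"
  assumes p: "\<And>i. i \<in> I \<Longrightarrow> free_ultrafilter (p i)"
    and J: "infinite J" "inj_on x J" "\<And>j. j \<in> J \<Longrightarrow> fst (x j) \<in> I"
  obtains K where "infinite K" "K \<subseteq> J" "\<And>i. i \<in> I \<Longrightarrow> \<not> eventually (\<lambda>n. (i, n) \<in> x ` K) (p i)"
proof (cases "\<exists>i. infinite {j \<in> J. fst (x j) = i}")
  case True
  then obtain i where i: "infinite {j \<in> J. fst (x j) = i}" (is "infinite ?L") by blast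
  then have "i \<in> I" using J(3) by (metis (mono_tags, lifting) empty_Collect_eq finite.emptyI)
  obtain e :: "nat \<Rightarrow> nat" where "strict_mono e" "\<And>n. e n \<in> ?L" using infinite_enumerate[OF i] by blast
  then have e: "inj e" "range e \<subseteq> ?L" by (auto simp: strict_mono_imp_inj_on)
  define L where "L r = e ` {n. even n = r}" for r :: bool
  have infL: "infinite (L r)" for r
  proof -
    have "infinite {n::nat. even n = r}"
      unfolding infinite_nat_iff_unbounded_le
    proof
      fix m :: nat
      show "\<exists>n\<ge>m. n \<in> {n. even n = r}"
        by (rule exI[of _ "if even m = r then m else Suc m"]) auto
    qed
    then show ?thesis unfolding L_def using e(1) by (meson finite_imageD inj_on_subset subset_UNIV)
  qed
  have LJ: "L r \<subseteq> J" for r using e(2) by (auto simp: L_def)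
  have "\<exists>r. \<not> eventually (\<lambda>n. (i, n) \<in> x ` L r) (p i)"
  proof (rule ccontr)
    assume "\<nexists>r. \<not> eventually (\<lambda>n. (i, n) \<in> x ` L r) (p i)"
    then have "eventually (\<lambda>n. (i, n) \<in> x ` L True \<and> (i, n) \<in> x ` L False) (p i)"
      by (intro eventually_conj) blast+
    moreover have "x ` L True \<inter> x ` L False = {}"
    proof -
      have "L True \<inter> L False = {}" using injD[OF e(1)] by (auto simp: L_def)
      then show ?thesis using inj_on_image_Int[OF J(2) LJ[of True] LJ[of False]] by simp
    qed
    ultimately have "eventually (\<lambda>n. False) (p i)"
      by (elim eventually_mono) blast
    then show False using p[OF \<open>i \<in> I\<close>]
      by (simp add: free_ultrafilter_def ultrafilter_def trivial_limit_def)
  qed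
  then obtain r where r: "\<not> eventually (\<lambda>n. (i, n) \<in> x ` L r) (p i)" by blast
  have "\<not> eventually (\<lambda>n. (i', n) \<in> x ` L r) (p i')" if "i' \<in> I" for i'
  proof (cases "i' = i")
    case False
    moreover have "fst (x j) = i" if "j \<in> L r" for j using e(2) that by (auto simp: L_def)
    ultimately have "(i', n) \<notin> x ` L r" for n by (metis fst_conv imageE)
    then show ?thesis using p[OF that]
      by (simp add: free_ultrafilter_def ultrafilter_def trivial_limit_def)
  qed (use r in simp)
  then show ?thesis using that infL LJ by blast
next
  case False
  have "infinite ((fst \<circ> x) ` J)"
    using False J(1) inf_img_fin_dom'[of "fst \<circ> x" J]
    by (auto simp: vimage_def Int_def conj_commute)
  moreover obtain K where K: "K \<subseteq> J" "inj_on (fst \<circ> x) K" "(fst \<circ> x) ` J = (fst \<circ> x) ` K"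
    using subset_image_inj[of "(fst \<circ> x) ` J" "fst \<circ> x" J] by auto
  ultimately have "infinite K" by auto
  moreover have "\<not> eventually (\<lambda>n. (i, n) \<in> x ` K) (p i)" if "i \<in> I" for i
  proof -
    have "finite {n. (i, n) \<in> x ` K}"
    proof (cases "\<exists>m. (i, m) \<in> x ` K")
      case True
      then obtain m where m: "(i, m) \<in> x ` K" by blast
      have "{n. (i, n) \<in> x ` K} \<subseteq> {m}"
        using m K(2) by (auto simp: inj_on_def) (metis fst_conv snd_conv)
      then show ?thesis using finite_subset by blast
    qed auto
    from free_ultrafilter_not_eventually_finite[OF p[OF that] this] show ?thesis by simp
  qed
  ultimately show ?thesis using that K(1) by blast
qed

text \<open>In either case infinitely many \<open>D j\<close> are made to contain exactly one
  element of value 1; disjointness keeps the choices for different \<open>j\<close> apart. If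
  infinitely many \<open>D j\<close> contain a generator \<open>(i, Some n)\<close>, one such
  generator is picked from each. Otherwise all but finitely many \<open>D j\<close> consist of
  limits only.\<close>

lemma ex_odd_on_disjoint_sets:
  fixes D :: "nat \<Rightarrow> ('i \<times> nat option) set"
  assumes p: "\<And>i. i \<in> I \<Longrightarrow> free_ultrafilter (p i)"
    and D: "\<And>j. D j \<subseteq> I \<times> UNIV" "\<And>j. D j \<noteq> {}" "disjoint_family D"
  shows "\<exists>c. infinite {j. odd (card {x \<in> D j. ultra_extend p c x})}"
proof -
  have uniq: "i = j" if "x \<in> D i" "x \<in> D j" for x i j
    using D(3) that by (auto simp: disjoint_family_on_def)
  define J where "J = {j. \<exists>i n. (i, Some n) \<in> D j}"
  show ?thesis
  proof (cases "finite J")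
    case False
    have "\<forall>j. \<exists>y. j \<in> J \<longrightarrow> (fst y, Some (snd y)) \<in> D j" by (auto simp: J_def)
    then obtain x where x: "\<And>j. j \<in> J \<Longrightarrow> (fst (x j), Some (snd (x j))) \<in> D j" by metis
    have "inj_on x J" using x uniq by (metis inj_onI)
    moreover have "fst (x j) \<in> I" if "j \<in> J" for j using x[OF that] D(1) by blast
    ultimately obtain K where K: "infinite K" "K \<subseteq> J"
      "\<And>i. i \<in> I \<Longrightarrow> \<not> eventually (\<lambda>n. (i, n) \<in> x ` K) (p i)"
      using ex_infinite_subset_not_in_ultrafilters[of I p J x] p False by blast
    \<comment> \<open>By the choice of \<open>K\<close> all limits get the value 0, so only the
      picked generators count.\<close>
    define c where "c = (\<lambda>i n. (i, n) \<in> x ` K)"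
    have "odd (card {y \<in> D j. ultra_extend p c y})" if "j \<in> K" for j
    proof -
      have "{y \<in> D j. ultra_extend p c y} = {(fst (x j), Some (snd (x j)))}"
      proof (rule equalityI, rule subrelI)
        fix i m assume "(i, m) \<in> {y \<in> D j. ultra_extend p c y}"
        then have y: "(i, m) \<in> D j" "ultra_extend p c (i, m)" by simp_all
        show "(i, m) \<in> {(fst (x j), Some (snd (x j)))}"
        proof (cases m)
          case None
          then show ?thesis using y K(3)[of i] D(1) by (auto simp: c_def)
        next
          case (Some n)
          then obtain k where k: "k \<in> K" "x k = (i, n)" using y by (auto simp: c_def)
          then have "k = j" using x[of k] K(2) y Some uniq by auto
          then show ?thesis using k Some by simp
        qed
      next
        have "(fst (x j), Some (snd (x j))) \<in> D j" using x that K(2) by blast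
        then show "{(fst (x j), Some (snd (x j)))} \<subseteq> {y \<in> D j. ultra_extend p c y}"
          using that by (simp add: c_def)
      qed
      then show ?thesis by simp
    qed
    then have "K \<subseteq> {j. odd (card {y \<in> D j. ultra_extend p c y})}" by blast
    then show ?thesis using K(1) infinite_super by blast
  next
    case True
    have "\<forall>j. \<exists>i. j \<notin> J \<longrightarrow> (i, None) \<in> D j"
    proof (intro allI)
      fix j
      obtain i m where "(i, m) \<in> D j" using D(2) by fastforce
      then show "\<exists>i. j \<notin> J \<longrightarrow> (i, None) \<in> D j" by (cases m) (auto simp: J_def)
    qed
    then obtain q where q: "\<And>j. j \<notin> J \<Longrightarrow> (q j, None) \<in> D j" by metis
    \<comment> \<open>A sequence constant in \<open>n\<close> passes its value on to its limit, so
      the values of the limits can be chosen at will.\<close>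
    define c where "c = (\<lambda>i (n::nat). i \<in> q ` (- J))"
    have "odd (card {y \<in> D j. ultra_extend p c y})" if "j \<notin> J" for j
    proof -
      have "{y \<in> D j. ultra_extend p c y} = {(q j, None)}"
      proof (rule equalityI, rule subrelI)
        fix i m assume "(i, m) \<in> {y \<in> D j. ultra_extend p c y}"
        then have y: "(i, m) \<in> D j" "ultra_extend p c (i, m)" by simp_all
        have m: "m = None" using y(1) that by (cases m) (auto simp: J_def)
        have "p i \<noteq> bot" using p[of i] D(1) y(1) by (auto simp: free_ultrafilter_def ultrafilter_def)
        then obtain k where k: "k \<notin> J" "i = q k"
          using y(2) m by (auto simp: c_def dest: eventually_happens')
        then have "k = j" using q[of k] y m uniq by auto
        then show "(i, m) \<in> {(q j, None)}" using k m by simp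
      next
        show "{(q j, None)} \<subseteq> {y \<in> D j. ultra_extend p c y}"
          using that q by (auto simp: c_def)
      qed
      then show ?thesis by simp
    qed
    then have "- J \<subseteq> {j. odd (card {y \<in> D j. ultra_extend p c y})}" by blast
    moreover have "infinite (- J)" using True by simp
    ultimately show ?thesis using infinite_super by blast
  qed
qed

text \<open>If the symmetric difference of two terms has odd count, then so has one of the two
  terms. Both indices are at least \<open>j\<close>, so odd terms occur arbitrarily late.\<close>

lemma ex_odd_infinitely_often:
  fixes s :: "nat \<Rightarrow> ('i \<times> nat option) set"
  assumes p: "\<And>i. i \<in> I \<Longrightarrow> free_ultrafilter (p i)"
    and s: "inj s" "\<And>k. finite (s k)" "\<And>k. s k \<subseteq> I \<times> UNIV"
  shows "\<exists>c. infinite {k. odd (card {x \<in> s k. ultra_extend p c x})}"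
proof -
  obtain a b where "\<forall>j. j \<le> a j \<and> j \<le> b j \<and> s (a j) \<noteq> s (b j)"
    and disj: "disjoint_family (\<lambda>j. sym_diff (s (a j)) (s (b j)))"
    using ex_disjoint_sym_diffs[OF s(1,2)] by (elim exE conjE)
  then have ab: "\<And>j. j \<le> a j" "\<And>j. j \<le> b j" "\<And>j. s (a j) \<noteq> s (b j)" by simp_all
  have "\<exists>c. infinite {j. odd (card {x \<in> sym_diff (s (a j)) (s (b j)). ultra_extend p c x})}"
  proof (rule ex_odd_on_disjoint_sets[OF p _ _ disj])
    show "sym_diff (s (a j)) (s (b j)) \<subseteq> I \<times> UNIV" for j using s(3) by blast
    show "sym_diff (s (a j)) (s (b j)) \<noteq> {}" for j using ab(3)[of j] by blast
  qed
  then obtain c where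
    c: "infinite {j. odd (card {x \<in> sym_diff (s (a j)) (s (b j)). ultra_extend p c x})}" ..
  have "\<exists>k\<ge>m. odd (card {x \<in> s k. ultra_extend p c x})" for m
  proof -
    obtain j where "j \<ge> m" "odd (card {x \<in> sym_diff (s (a j)) (s (b j)). ultra_extend p c x})"
      using c unfolding infinite_nat_iff_unbounded_le by blast
    then show ?thesis
      unfolding odd_card_sym_diff[OF s(2) s(2)] using ab(1,2) le_trans by meson
  qed
  then show ?thesis unfolding infinite_nat_iff_unbounded_le by blast
qed

section \<open>Finite sums of generators as points of the power\<close>

definition parity_point :: "'k set \<Rightarrow> ('k \<Rightarrow> 'x \<Rightarrow> bool) \<Rightarrow> 'x set \<Rightarrow> 'k \<Rightarrow> int" where
  "parity_point K v A = (\<lambda>\<xi>\<in>K. of_bool (odd (card {x \<in> A. v \<xi> x})))"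

lemma parity_point_in_PiE: "parity_point K v A \<in> (\<Pi>\<^sub>E \<xi>\<in>K. carrier (integer_mod_group 2))"
  by (auto simp: parity_point_def carrier_integer_mod_group)

lemma parity_point_singleton: "\<xi> \<in> K \<Longrightarrow> parity_point K v {x} \<xi> = of_bool (v \<xi> x)"
proof -
  have "{y. y = x \<and> v \<xi> y} = (if v \<xi> x then {x} else {})" by auto
  then show "\<xi> \<in> K \<Longrightarrow> parity_point K v {x} \<xi> = of_bool (v \<xi> x)"
    by (auto simp: parity_point_def)
qed

lemma parity_point_sym_diff:
  assumes "finite A" "finite B" "\<xi> \<in> K"
  shows "parity_point K v (sym_diff A B) \<xi> = (parity_point K v A \<xi> + parity_point K v B \<xi>) mod 2"
  using assms(3) by (simp add: parity_point_def odd_card_sym_diff[OF assms(1,2)] del: Un_iff Diff_iff)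

text \<open>A finite set stands for the sum of its elements, where \<open>v \<xi> x\<close> is the
  coordinate of \<open>x\<close> at \<open>\<xi>\<close>. Modulo 2, addition becomes symmetric
  difference and every element is its own inverse.\<close>

lemma subgroup_parity_points:
  "subgroup (parity_point K v ` Fpow X) (product_group K (\<lambda>_. integer_mod_group 2))"
    (is "subgroup ?H ?G")
proof (rule group.subgroupI)
  show "group ?G" by simp
  show "?H \<subseteq> carrier ?G" using parity_point_in_PiE by fastforce
  show "?H \<noteq> {}" by (auto simp: Fpow_def)
next
  fix x assume "x \<in> ?H"
  then obtain A where A: "x = parity_point K v A" by blast
  have "inv\<^bsub>?G\<^esub> x = x"
    unfolding A using parity_point_in_PiE[of K v A]
    by (subst inv_product_group) (auto simp: fun_eq_iff parity_point_def carrier_integer_mod_group)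
  with \<open>x \<in> ?H\<close> show "inv\<^bsub>?G\<^esub> x \<in> ?H" by simp
next
  fix x y assume "x \<in> ?H" "y \<in> ?H"
  then obtain A B where AB: "A \<in> Fpow X" "B \<in> Fpow X" "x = parity_point K v A" "y = parity_point K v B"
    by blast
  then have "x \<otimes>\<^bsub>?G\<^esub> y = parity_point K v (sym_diff A B)"
    using parity_point_sym_diff[of A B _ K v] parity_point_in_PiE[of K v "sym_diff A B"]
    by (auto simp: fun_eq_iff Fpow_def restrict_def PiE_def extensional_def)
  moreover have "sym_diff A B \<in> Fpow X" using AB by (auto simp: Fpow_def)
  ultimately show "x \<otimes>\<^bsub>?G\<^esub> y \<in> ?H" by blast
qed

section \<open>Open sets, limits and convergent sequences in the power\<close>

lemma limitin_discrete_topology: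
  "limitin (discrete_topology C) f l F \<longleftrightarrow> l \<in> C \<and> eventually (\<lambda>x. f x = l) F"
proof
  assume L: "limitin (discrete_topology C) f l F"
  then have "l \<in> C" by (simp add: limitin_def)
  moreover have "eventually (\<lambda>x. f x \<in> {l}) F"
    using L \<open>l \<in> C\<close> unfolding limitin_def openin_discrete_topology by blast
  ultimately show "l \<in> C \<and> eventually (\<lambda>x. f x = l) F" by simp
qed (auto simp: limitin_def elim: eventually_mono)

lemma openin_product_discrete_finite_support:
  assumes "openin (product_topology (\<lambda>_. discrete_topology C) K) V" "h \<in> V"
  obtains S where "finite S" "S \<subseteq> K"
    "\<And>y. y \<in> (\<Pi>\<^sub>E i\<in>K. C) \<Longrightarrow> (\<And>i. i \<in> S \<Longrightarrow> y i = h i) \<Longrightarrow> y \<in> V"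
proof -
  obtain U where U: "finite {i \<in> K. U i \<noteq> C}" "h \<in> Pi\<^sub>E K U" "Pi\<^sub>E K U \<subseteq> V"
    using assms unfolding openin_product_topology_alt by fastforce
  have "y \<in> V" if "y \<in> (\<Pi>\<^sub>E i\<in>K. C)" "\<And>i. i \<in> {i \<in> K. U i \<noteq> C} \<Longrightarrow> y i = h i" for y
  proof -
    have "y i \<in> U i" if "i \<in> K" for i
      using that \<open>y \<in> (\<Pi>\<^sub>E i\<in>K. C)\<close> \<open>\<And>i. i \<in> {i \<in> K. U i \<noteq> C} \<Longrightarrow> y i = h i\<close> U(2)
      by (cases "U i = C") (auto simp: PiE_iff)
    then have "y \<in> Pi\<^sub>E K U" using that(1) by (auto simp: PiE_iff)
    then show ?thesis using U(3) by blast
  qed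
  then show thesis using that U(1) by (metis (no_types, lifting) mem_Collect_eq subsetI)
qed

text \<open>Convergence is tested at each coordinate, where an ultrafilter decides a sequence of
  bits; the value at \<open>None\<close> is defined to be the one decided for.\<close>

lemma limitin_parity_points:
  assumes p: "ultrafilter (p i)"
  shows "limitin (product_topology (\<lambda>_. discrete_topology (carrier (integer_mod_group 2))) K)
           (\<lambda>n. parity_point K (\<lambda>\<xi>. ultra_extend p (u \<xi>)) {(i, Some n)})
           (parity_point K (\<lambda>\<xi>. ultra_extend p (u \<xi>)) {(i, None)}) (p i)"
proof -
  have ev: "eventually (\<lambda>n. u \<xi> i n = eventually (u \<xi> i) (p i)) (p i)" for \<xi>
  proof (cases "eventually (u \<xi> i) (p i)")
    case True
    then show ?thesis by simp
  next
    case False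
    then have "eventually (\<lambda>n. \<not> u \<xi> i n) (p i)"
      using p[unfolded ultrafilter_def, THEN conjunct2, THEN spec, of "{n. u \<xi> i n}"] by simp
    then show ?thesis using False by simp
  qed
  have *: "eventually (\<lambda>n. (of_bool (u \<xi> i n) :: int) = of_bool (eventually (u \<xi> i) (p i))) (p i)" for \<xi>
    by (rule eventually_mono[OF ev[of \<xi>]]) simp
  show ?thesis
    unfolding limitin_componentwise limitin_discrete_topology
  proof (intro conjI ballI)
    let ?q = "parity_point K (\<lambda>\<xi>. ultra_extend p (u \<xi>))"
    show "?q {(i, None)} \<in> extensional K"
      by (simp add: parity_point_def)
    show "eventually (\<lambda>n. ?q {(i, Some n)} \<in> topspace (product_topology
        (\<lambda>_. discrete_topology (carrier (integer_mod_group 2))) K)) (p i)"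
      by (simp add: parity_point_in_PiE)
    fix \<xi> assume "\<xi> \<in> K"
    then show "?q {(i, None)} \<xi> \<in> carrier (integer_mod_group 2)"
      and "eventually (\<lambda>n. ?q {(i, Some n)} \<xi> = ?q {(i, None)} \<xi>) (p i)"
      using * by (simp_all add: parity_point_singleton carrier_integer_mod_group)
  qed
qed

text \<open>Subtracting the limit from a non-trivial convergent sequence and passing to an injective
  subsequence gives distinct formal sums tending to 0, whereas \<open>odd\<close> supplies a
  coordinate at which they are 1 infinitely often.\<close>

lemma no_convergent_sequence_parity_points:
  fixes K :: "'k set" and X :: "'x set"
  assumes odd: "\<And>s. inj s \<Longrightarrow> range s \<subseteq> Fpow X \<Longrightarrow>
    \<exists>\<xi>\<in>K. infinite {k::nat. odd (card {x \<in> s k. v \<xi> x})}"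
  shows "\<not> has_nontrivial_convergent_sequence
    (subtopology (product_topology (\<lambda>_. discrete_topology (carrier (integer_mod_group 2))) K)
      (parity_point K v ` Fpow X))"
  unfolding has_nontrivial_convergent_sequence_def
proof clarify
  let ?Z = "product_topology (\<lambda>_. discrete_topology (carrier (integer_mod_group 2))) K"
  fix x :: "nat \<Rightarrow> 'k \<Rightarrow> int" and l
  assume x: "\<forall>n. x n \<in> topspace (subtopology ?Z (parity_point K v ` Fpow X))"
    and lim: "limitin (subtopology ?Z (parity_point K v ` Fpow X)) x l sequentially"
    and ne: "\<nexists>c. eventually (\<lambda>n. x n = c) sequentially"
  have "\<forall>n. \<exists>A. A \<in> Fpow X \<and> x n = parity_point K v A" using x by auto
  then obtain F where F: "\<And>n. F n \<in> Fpow X" "\<And>n. x n = parity_point K v (F n)" by metis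
  obtain L where L: "L \<in> Fpow X" "l = parity_point K v L"
    using lim by (auto simp: limitin_subtopology)
  have conv: "eventually (\<lambda>n. x n \<xi> = l \<xi>) sequentially" if "\<xi> \<in> K" for \<xi>
    using lim that by (simp add: limitin_subtopology limitin_componentwise limitin_discrete_topology)
  have ext: "\<exists>\<xi>\<in>K. parity_point K v A \<xi> \<noteq> parity_point K v B \<xi>"
    if "parity_point K v A \<noteq> parity_point K v B" for A B
    using that PiE_ext[OF parity_point_in_PiE[of K v A] parity_point_in_PiE[of K v B]] by blast
  define M where "M = {n. x n \<noteq> l}"
  have "infinite M"
    using ne by (auto simp: M_def eventually_cofinite simp flip: cofinite_eq_sequentially)
  \<comment> \<open>A value \<open>y\<close> other than \<open>l\<close> cannot recur infinitely
    often, since at a coordinate separating the two the sequence is eventually equal to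
    \<open>l\<close>. So infinitely many values are taken, which yields an injective
    subsequence.\<close>
  have "finite {n \<in> M. x n = y}" for y
  proof (cases "\<exists>n\<in>M. x n = y")
    case True
    then obtain \<xi> where \<xi>: "\<xi> \<in> K" "y \<xi> \<noteq> l \<xi>"
      using ext F(2) L(2) unfolding M_def by (metis mem_Collect_eq)
    then have "finite {n. x n \<xi> \<noteq> l \<xi>}"
      using conv[OF \<xi>(1)] by (simp add: eventually_cofinite flip: cofinite_eq_sequentially)
    moreover have "{n \<in> M. x n = y} \<subseteq> {n. x n \<xi> \<noteq> l \<xi>}" using \<xi>(2) by auto
    ultimately show ?thesis by (rule rev_finite_subset)
  qed (auto intro: finite_subset[of _ "{}"])
  then have "infinite (x ` M)"
    using \<open>infinite M\<close> inf_img_fin_dom'[of x M] by (auto simp: vimage_def Int_def conj_commute)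
  moreover obtain M' where M': "M' \<subseteq> M" "inj_on x M'" "x ` M = x ` M'"
    using subset_image_inj[of "x ` M" x M] by auto
  ultimately have "infinite M'" by auto
  then obtain e :: "nat \<Rightarrow> nat" where e: "strict_mono e" "\<And>n. e n \<in> M'"
    using infinite_enumerate by blast
  \<comment> \<open>In characteristic 2 this formal sum represents
    \<open>x (e k) - l\<close>.\<close>
  define s where "s k = sym_diff (F (e k)) L" for k
  have "inj s"
  proof (rule injI)
    fix i j assume "s i = s j"
    then have "F (e i) = F (e j)" unfolding s_def by blast
    then have "x (e i) = x (e j)" by (simp add: F(2))
    then show "i = j" using M'(2) e by (meson inj_onD strict_mono_eq)
  qed
  moreover have "range s \<subseteq> Fpow X" using F(1) L(1) by (force simp: s_def Fpow_def)
  ultimately obtain \<xi> where \<xi>: "\<xi> \<in> K" "infinite {k. odd (card {y \<in> s k. v \<xi> y})}"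
    using odd by blast
  obtain N where N: "\<And>n. n \<ge> N \<Longrightarrow> x n \<xi> = l \<xi>"
    using conv[OF \<xi>(1)] by (auto simp: eventually_sequentially)
  obtain k where k: "k \<ge> N" "odd (card {y \<in> s k. v \<xi> y})"
    using \<xi>(2) unfolding infinite_nat_iff_unbounded_le by blast
  have "x (e k) \<xi> = l \<xi>" using N k(1) strict_mono_imp_increasing[OF e(1), of k] by simp
  moreover have "finite (F (e k))" "finite L" using F(1) L(1) by (auto simp: Fpow_def)
  ultimately show False
    using k(2) \<xi>(1) unfolding s_def
    by (simp add: odd_card_sym_diff F(2) L(2) parity_point_def of_bool_def del: Un_iff Diff_iff split: if_splits)
qed

section \<open>Cardinal arithmetic under \<kappa>^\<omega> = \<kappa>\<close>

lemma card_of_sequences_ordLeq: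
  assumes "\<kappa> ^c natLeq =o \<kappa>" "|A| \<le>o \<kappa>"
  shows "|{f :: nat \<Rightarrow> 'a. range f \<subseteq> A}| \<le>o \<kappa>"
proof -
  have "{f :: nat \<Rightarrow> 'a. range f \<subseteq> A} = Func UNIV A" by (auto simp: Func_def)
  then have "|{f :: nat \<Rightarrow> 'a. range f \<subseteq> A}| = |A| ^c natLeq"
    by (simp add: cexp_def Field_card_of Field_natLeq)
  also have "|A| ^c natLeq \<le>o \<kappa> ^c natLeq"
    by (rule cexp_mono1[OF assms(2) natLeq_Card_order])
  finally show ?thesis using assms(1) ordLeq_ordIso_trans by blast
qed

lemma card_of_Fpow_ordLeq:
  fixes A :: "'a set"
  assumes "Card_order \<kappa>" "cinfinite \<kappa>" "\<kappa> ^c natLeq =o \<kappa>" "|A| \<le>o \<kappa>"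
  shows "|Fpow A| \<le>o \<kappa>"
proof -
  let ?S = "{f :: nat \<Rightarrow> 'a. range f \<subseteq> A}"
  have inf: "infinite (Field \<kappa>)" using assms(2) by (simp add: cinfinite_def)
  have "Fpow A \<subseteq> {{}} \<union> range ` ?S"
  proof
    fix B assume B: "B \<in> Fpow A"
    show "B \<in> {{}} \<union> range ` ?S"
    proof (cases "B = {}")
      case False
      moreover have "countable B" using B by (simp add: Fpow_def countable_finite)
      ultimately have "range (from_nat_into B) = B" by (simp add: range_from_nat_into)
      with B show ?thesis by (force simp: Fpow_def)
    qed simp
  qed
  then have "|Fpow A| \<le>o |{{}} \<union> range ` ?S|" by (rule card_of_mono1)
  also have "|{{}} \<union> range ` ?S| \<le>o \<kappa>"
  proof (rule card_of_Un_ordLeq_infinite_Field[OF inf _ _ assms(1)])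
    have "|{{}::'a set}| \<le>o |Field \<kappa>|" using inf by (intro card_of_singl_ordLeq) auto
    then show "|{{}::'a set}| \<le>o \<kappa>"
      using card_of_Field_ordIso[OF assms(1)] ordLeq_ordIso_trans by blast
    show "|range ` ?S| \<le>o \<kappa>"
      using card_of_image card_of_sequences_ordLeq[OF assms(3,4)] by (rule ordLeq_transitive)
  qed
  finally show ?thesis .
qed

text \<open>Two points of the field already give 2^\<omega> sequences, so \<kappa> =
  \<kappa>^\<omega> \<ge> 2^\<omega>, which is uncountable by Cantor. This lets the coordinates
  reserved for one sequence outnumber its countably many constraints.\<close>

lemma uncountable_Field_if_cexp_natLeq:
  fixes \<kappa> :: "'a rel"
  assumes "Card_order \<kappa>" "cinfinite \<kappa>" "\<kappa> ^c natLeq =o \<kappa>"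
  shows "uncountable (Field \<kappa>)"
proof
  assume count: "countable (Field \<kappa>)"
  let ?S = "{f :: nat \<Rightarrow> 'a. range f \<subseteq> Field \<kappa>}"
  have "|Field \<kappa>| =o \<kappa>" using assms(1) by (rule card_of_Field_ordIso)
  then have "|?S| \<le>o \<kappa>" using card_of_sequences_ordLeq assms(3) ordIso_imp_ordLeq by blast
  then have "|?S| \<le>o |Field \<kappa>|"
    using \<open>|Field \<kappa>| =o \<kappa>\<close> ordIso_symmetric ordLeq_ordIso_trans by blast
  then obtain g where g: "inj_on g ?S" "g ` ?S \<subseteq> Field \<kappa>" unfolding card_of_ordLeq[symmetric] by blast
  obtain a where a: "a \<in> Field \<kappa>"
    using assms(2) by (metis cinfinite_def ex_in_conv finite.emptyI)
  obtain b where b: "b \<in> Field \<kappa>" "b \<noteq> a"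
    using assms(2) by (metis cinfinite_def finite.simps insertI1 subsetI subset_singletonD)
  define h where "h T n = (if n \<in> T then a else b)" for T and n :: nat
  have "inj h"
    using b(2) by (intro injI) (auto simp: h_def fun_eq_iff split: if_splits)
  moreover have h: "range h \<subseteq> ?S" using a b(1) by (auto simp: h_def)
  ultimately have "inj (g \<circ> h)" using comp_inj_on[OF _ inj_on_subset[OF g(1)]] by blast
  moreover have "range (g \<circ> h) \<subseteq> Field \<kappa>" using g(2) h by fastforce
  ultimately have "countable (UNIV :: nat set set)"
    using count by (meson countable_image_inj_on countable_subset)
  then have "\<exists>f :: nat \<Rightarrow> nat set. range f = UNIV"
    using range_from_nat_into[OF UNIV_not_empty] by blast
  then show False using Cantors_theorem[of "UNIV :: nat set"] by auto
qed

section \<open>Construction of the subgroup and verification of its properties\<close>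

theorem theorem1p2:
  fixes \<kappa> :: "'k rel" and P :: "nat filter set"
  assumes "Card_order \<kappa>" and "cinfinite \<kappa>" and "\<kappa> ^c natLeq =o \<kappa>"
    and "P \<noteq> {}" and "P \<subseteq> beta_remainder" and "|P| \<le>o \<kappa>"
  shows "\<exists>H. subgroup H (Z2_power_group \<kappa>) \<and>
             Z2_power_topology \<kappa> closure_of H = topspace (Z2_power_topology \<kappa>) \<and>
             strongly_P_pseudocompact P (subtopology (Z2_power_topology \<kappa>) H) \<and>
             \<not> has_nontrivial_convergent_sequence (subtopology (Z2_power_topology \<kappa>) H)"
proof -
  define K where "K = Field \<kappa>"
  have K: "infinite K" "uncountable K" "|K| =o \<kappa>"
    using assms(2) uncountable_Field_if_cexp_natLeq[OF assms(1-3)] card_of_Field_ordIso[OF assms(1)]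
    by (auto simp: K_def cinfinite_def)
  have Times: "|A \<times> B| \<le>o \<kappa>" if "|A| \<le>o \<kappa>" "|B| \<le>o \<kappa>" for A :: "'x set" and B :: "'y set"
    using card_of_Times_ordLeq_infinite_Field K(1) that assms(1) by (auto simp: K_def)
  have countable_le: "|A| \<le>o \<kappa>" if count: "countable A" for A :: "'x set"
  proof -
    obtain f :: "'x \<Rightarrow> nat" where "inj_on f A" using count by (auto simp: countable_def)
    then have "|A| \<le>o |UNIV :: nat set|" by (rule card_of_ordLeqI) simp
    also have "|UNIV :: nat set| =o natLeq" by (rule card_of_nat)
    also have "natLeq \<le>o \<kappa>" using assms(1,2) by (simp add: natLeq_ordLeq_cinfinite)
    finally show ?thesis .
  qed

  text \<open>A finite set \<open>F\<close> of pairs \<open>(\<xi>, b)\<close> prescribes the coordinates in \<open>fst ` F\<close> and so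
    encodes a basic open set.\<close>
  define I where "I = P \<times> {F :: nat \<Rightarrow> ('k \<times> bool) set. range F \<subseteq> Fpow (K \<times> UNIV)}"
  define X where "X = I \<times> (UNIV :: nat option set)"
  define S where "S = {s :: nat \<Rightarrow> _. range s \<subseteq> Fpow X}"
  have Kle: "|K| \<le>o \<kappa>" using K(3) by (rule ordIso_imp_ordLeq)
  note seq = card_of_sequences_ordLeq[OF assms(3)] card_of_Fpow_ordLeq[OF assms(1-3)]
  have "|I| \<le>o \<kappa>"
    unfolding I_def by (intro Times[OF assms(6)] seq Times[OF Kle] countable_le) simp
  then have "|S \<times> K| \<le>o \<kappa>"
    unfolding S_def X_def by (intro Times[OF _ Kle] seq Times[OF _ countable_le]) simp_all
  then have "|S \<times> K| \<le>o |K|"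
    using K(3) ordIso_symmetric ordLeq_ordIso_trans by blast
  moreover have "S \<times> K \<noteq> {}"
  proof -
    have "(\<lambda>_. {}) \<in> S" by (auto simp: S_def Fpow_def)
    moreover have "K \<noteq> {}" using K(1) by auto
    ultimately show ?thesis by auto
  qed
  \<comment> \<open>The coordinates \<open>\<xi>\<close> with \<open>fst (b \<xi>) = s\<close> are
    those reserved for \<open>s\<close>; the second factor \<open>K\<close> makes them
    numerous.\<close>
  ultimately obtain b where b: "b ` K = S \<times> K"
    using card_of_ordLeq2[of "S \<times> K" K] by auto

  have free: "free_ultrafilter (fst i)" if "i \<in> I" for i
    using that assms(5) by (auto simp: I_def beta_remainder_def)
  \<comment> \<open>An index is a pair whose first component is its ultrafilter, hence
    \<open>fst\<close> in the place of \<open>p\<close>.\<close>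
  have "\<forall>s. \<exists>c. s \<in> S \<longrightarrow> inj s \<longrightarrow> infinite {k. odd (card {x \<in> s k. ultra_extend fst c x})}"
  proof (intro allI)
    fix s
    show "\<exists>c. s \<in> S \<longrightarrow> inj s \<longrightarrow> infinite {k. odd (card {x \<in> s k. ultra_extend fst c x})}"
    proof (cases "s \<in> S \<and> inj s")
      case True
      then have "finite (s k)" "s k \<subseteq> I \<times> UNIV" for k
        by (auto simp: S_def X_def Fpow_def)
      then show ?thesis using ex_odd_infinitely_often[of I fst s] free True by blast
    qed blast
  qed
  from choice[OF this] obtain c where
    c: "\<And>s. s \<in> S \<Longrightarrow> inj s \<Longrightarrow> infinite {k. odd (card {x \<in> s k. ultra_extend fst (c s) x})}"
    by blast
  \<comment> \<open>Constraints from the open sets take precedence; at all other places coordinate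
    \<open>\<xi>\<close> serves the sequence it is reserved for.\<close>
  define u where "u \<xi> i n =
      (if \<xi> \<in> fst ` snd i n then (\<xi>, True) \<in> snd i n else c (fst (b \<xi>)) i n)" for \<xi> i n
  define v where "v = (\<lambda>\<xi>. ultra_extend fst (u \<xi>))"
  define H where "H = parity_point K v ` Fpow X"
  define Z where "Z = product_topology (\<lambda>_. discrete_topology (carrier (integer_mod_group 2))) K"
  have Z: "Z2_power_topology \<kappa> = Z" by (simp add: Z2_power_topology_def Z_def K_def)
  have in_H: "parity_point K v {(i, m)} \<in> H" if "i \<in> I" for i m
    using that by (auto simp: H_def X_def Fpow_def)

  \<comment> \<open>Both density and pseudocompactness come from this: the generators of a single
    index pass through any given sequence of nonempty open sets.\<close>
  have hit: "\<exists>i\<in>I. fst i = p \<and> (\<forall>n. parity_point K v {(i, Some n)} \<in> V n)"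
    if p: "p \<in> P" and V: "\<And>n. openin Z (V n)" "\<And>n. V n \<noteq> {}" for p V
  proof -
    have "\<forall>n. \<exists>h. h \<in> V n" using V(2) by blast
    then obtain h where h: "\<And>n. h n \<in> V n" by metis
    have h01: "h n \<xi> = 0 \<or> h n \<xi> = 1" if "\<xi> \<in> K" for n \<xi>
    proof -
      have "h n \<in> topspace Z" using openin_subset[OF V(1)] h by blast
      then have "h n \<xi> \<in> {0..<2}" using that by (auto simp: Z_def carrier_integer_mod_group)
      then show ?thesis by auto
    qed
    have "\<forall>n. \<exists>T. finite T \<and> T \<subseteq> K \<and> (\<forall>y \<in> \<Pi>\<^sub>E \<xi>\<in>K. carrier (integer_mod_group 2).
        (\<forall>\<xi>\<in>T. y \<xi> = h n \<xi>) \<longrightarrow> y \<in> V n)"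
      using openin_product_discrete_finite_support[OF V(1)[unfolded Z_def] h] by metis
    then obtain T where T: "\<And>n. finite (T n)" "\<And>n. T n \<subseteq> K"
      "\<And>n y. y \<in> (\<Pi>\<^sub>E \<xi>\<in>K. carrier (integer_mod_group 2)) \<Longrightarrow> \<forall>\<xi>\<in>T n. y \<xi> = h n \<xi> \<Longrightarrow> y \<in> V n"
      by metis
    \<comment> \<open>The restriction of \<open>h n\<close> to the support \<open>T n\<close>,
      written as a graph with \<open>True\<close> for 1.\<close>
    define F where "F n = (\<lambda>\<xi>. (\<xi>, h n \<xi> = 1)) ` T n" for n
    have "(p, F) \<in> I" using p T(1,2) by (auto simp: I_def F_def Fpow_def)
    moreover have "parity_point K v {((p, F), Some n)} \<in> V n" for n
    proof (rule T(3)[OF parity_point_in_PiE], intro ballI)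
      fix \<xi> assume \<xi>: "\<xi> \<in> T n"
      then have "v \<xi> ((p, F), Some n) \<longleftrightarrow> h n \<xi> = 1"
        by (force simp: v_def u_def F_def)
      then show "parity_point K v {((p, F), Some n)} \<xi> = h n \<xi>"
        using h01[of \<xi> n] T(2)[of n] \<xi> by (auto simp: parity_point_singleton)
    qed
    ultimately show ?thesis by (intro bexI[of _ "(p, F)"]) auto
  qed

  have "subgroup H (Z2_power_group \<kappa>)"
    unfolding H_def Z2_power_group_def K_def by (rule subgroup_parity_points)
  moreover have "Z closure_of H = topspace Z"
    unfolding dense_intersects_open
  proof (intro allI impI)
    fix V assume V: "openin Z V \<and> V \<noteq> {}"
    obtain p where "p \<in> P" using assms(4) by blast
    \<comment> \<open>For density a constant sequence of open sets suffices.\<close>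
    then obtain i where "i \<in> I" "parity_point K v {(i, Some 0)} \<in> V"
      using hit[of p "\<lambda>_. V"] V by auto
    then show "H \<inter> V \<noteq> {}" using in_H by blast
  qed
  moreover have "strongly_P_pseudocompact P (subtopology Z H)"
    unfolding strongly_P_pseudocompact_def strongly_p_pseudocompact_def
  proof (intro ballI allI impI)
    fix p and U :: "nat \<Rightarrow> ('k \<Rightarrow> int) set"
    assume p: "p \<in> P" and U: "\<forall>n. openin (subtopology Z H) (U n) \<and> U n \<noteq> {}"
    have "\<forall>n. \<exists>V. openin Z V \<and> U n = V \<inter> H" using U by (simp add: openin_subtopology)
    then obtain V where V: "\<And>n. openin Z (V n)" "\<And>n. U n = V n \<inter> H" by metis
    have "V n \<noteq> {}" for n using U V(2) by blast
    then obtain i where i: "i \<in> I" "fst i = p" "\<And>n. parity_point K v {(i, Some n)} \<in> V n"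
      using hit[OF p V(1), of "\<lambda>n. n"] by blast
    have "ultrafilter (fst i)" using free[OF i(1)] by (simp add: free_ultrafilter_def)
    then have "limitin Z (\<lambda>n. parity_point K v {(i, Some n)}) (parity_point K v {(i, None)}) p"
      unfolding Z_def v_def i(2)[symmetric] by (rule limitin_parity_points)
    then have "limitin (subtopology Z H) (\<lambda>n. parity_point K v {(i, Some n)})
        (parity_point K v {(i, None)}) p"
      using in_H[OF i(1)] by (simp add: limitin_subtopology)
    then show "\<exists>x. (\<forall>n. x n \<in> U n) \<and> (\<exists>l. limitin (subtopology Z H) x l p)"
      using V(2) i(3) in_H[OF i(1)] by (intro exI[of _ "\<lambda>n. parity_point K v {(i, Some n)}"]) auto
  qed
  moreover have "\<not> has_nontrivial_convergent_sequence (subtopology Z H)"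
    unfolding Z_def H_def
  proof (rule no_convergent_sequence_parity_points)
    fix s :: "nat \<Rightarrow> ((nat filter \<times> (nat \<Rightarrow> ('k \<times> bool) set)) \<times> nat option) set"
    assume s: "inj s" "range s \<subseteq> Fpow X"
    then have "s \<in> S" by (simp add: S_def)
    have sk: "finite (s k)" "s k \<subseteq> X" for k
      using s(2) rangeI[of s k] by (auto simp: Fpow_def)
    \<comment> \<open>The union runs over all \<open>n\<close> for each index occurring in
      \<open>s\<close>, because a limit \<open>(i, None)\<close> depends on every generator of
      \<open>i\<close>. It is still countable, as all terms and supports are finite.\<close>
    define B where "B = (\<Union>k. \<Union>x\<in>s k. \<Union>n. fst ` snd (fst x) n)"
    have "countable B"
      unfolding B_def
    proof (intro countable_UN countable_image)
      show "countable (s k)" for k using sk(1) by (rule countable_finite)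
      fix k x n assume "x \<in> s k"
      then have "x \<in> X" using sk(2) by blast
      then have "range (snd (fst x)) \<subseteq> Fpow (K \<times> UNIV)" by (simp add: X_def I_def mem_Times_iff)
      then have "snd (fst x) n \<in> Fpow (K \<times> UNIV)" by blast
      then show "countable (snd (fst x) n)" by (simp add: Fpow_def countable_finite)
    qed auto
    \<comment> \<open>The second component of \<open>b\<close> maps this fibre onto the uncountable
      set \<open>K\<close>.\<close>
    moreover have "uncountable {\<xi> \<in> K. fst (b \<xi>) = s}"
    proof
      assume "countable {\<xi> \<in> K. fst (b \<xi>) = s}"
      then have "countable ((snd \<circ> b) ` {\<xi> \<in> K. fst (b \<xi>) = s})" by (rule countable_image)
      moreover have "K \<subseteq> (snd \<circ> b) ` {\<xi> \<in> K. fst (b \<xi>) = s}"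
      proof
        fix \<xi> assume "\<xi> \<in> K"
        with \<open>s \<in> S\<close> have "(s, \<xi>) \<in> b ` K" using b by blast
        then obtain \<eta> where "\<eta> \<in> K" "b \<eta> = (s, \<xi>)" by force
        then show "\<xi> \<in> (snd \<circ> b) ` {\<xi> \<in> K. fst (b \<xi>) = s}" by force
      qed
      ultimately show False using K(2) countable_subset by blast
    qed
    ultimately have "\<not> {\<xi> \<in> K. fst (b \<xi>) = s} \<subseteq> B" by (meson countable_subset)
    then obtain \<xi> where \<xi>: "\<xi> \<in> K" "fst (b \<xi>) = s" "\<xi> \<notin> B" by auto
    have "v \<xi> x = ultra_extend fst (c s) x" if "x \<in> s k" for x k
    proof -
      \<comment> \<open>Outside \<open>B\<close> the two agree as functions of \<open>n\<close>, so
        their limits along the ultrafilter agree as well.\<close>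
      have "u \<xi> (fst x) = c s (fst x)"
        using \<xi>(2,3) that by (fastforce simp: u_def B_def fun_eq_iff)
      then show ?thesis by (simp add: v_def ultra_extend_def split: option.split)
    qed
    then have "{x \<in> s k. v \<xi> x} = {x \<in> s k. ultra_extend fst (c s) x}" for k by blast
    then show "\<exists>\<xi>\<in>K. infinite {k. odd (card {x \<in> s k. v \<xi> x})}"
      using c[OF \<open>s \<in> S\<close> s(1)] \<xi>(1) by (intro bexI[of _ \<xi>]) (simp_all only: simp_thms)
  qed
  ultimately show ?thesis unfolding Z by blast
qed

end
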